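(* Let $j\ge1$, let $A$ be an $n\times n$ matrix, $b$ a vector of length $n$, and let the computed vectors $\bar x_k,\bar p_k,\bar v_k$, the scalars $\bar\gamma_k,\bar\delta_k,\bar\eta_k,\bar\lambda_k,\bar\zeta_k$, the local rounding errors $\xi^{\bar x}_k,\xi^{\bar p}_k$, and the matrices $\bar V_{j+1},\bar{\boldsymbol V}_{j+1},\bar H_{j,j},\bar H_{j+1,j},\bar\Delta_{j+1,j},\Theta^{\bar x}_j,\Theta^{\bar p}_j$ be as described in the context. Let $\bar y_j=\bar H_{j,j}^{-1}\|\bar r_0\|e_1$, let $\bar{\mathbf r}_j=b-A\bar x_j$ be the true residual, and let $\bar r_j=\bar r_0-\bar V_{j+1}\bar H_{j+1,j}\bar y_j$ be the implicitly computed residual, where $\bar r_0=b-A\bar x_0$. Then $$\bar{\mathbf r}_j=\bar r_j-(\bar{\boldsymbol V}_{j+1}-\bar V_{j+1})\,\bar\Delta_{j+1,j}\,\bar y_j+A\,\Theta^{\bar p}_j\,\bar y_j-A\,\Theta^{\bar x}_j\,\bar{\boldsymbol 1},$$ where $\bar{\boldsymbol 1}=[1,1,\dots,1]^T$ has length $j$.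
   Context: This models the finite precision deep pipelined Conjugate Gradient method p($l$)-CG. All vectors of the iteration have length $n$; $\|\cdot\|$ is the Euclidean norm; $e_1$ is the first unit vector of length $j$; vector and scalar indices, as well as row and column indices of matrices, start at $0$; any vector or scalar with a negative index is zero. Given are computed basis vectors $\bar v_0,\dots,\bar v_j$ (arbitrary computed vectors) and scalars $\bar\gamma_0,\dots,\bar\gamma_{j-1}$, $\bar\delta_0,\dots,\bar\delta_{j-1}$ with all $\bar\delta_k\neq0$. The true basis vectors are $\bar{\mathbf v}_0=\bar v_0$ and $\bar{\mathbf v}_{k+1}=(A\bar v_k-\bar\gamma_k\bar v_k-\bar\delta_{k-1}\bar v_{k-1})/\bar\delta_k$ for $0\le k<j$. Set $\bar V_{j+1}=[\bar v_0,\dots,\bar v_j]$ and $\bar{\boldsymbol V}_{j+1}=[\bar{\mathbf v}_0,\dots,\bar{\mathbf v}_j]$. $\bar H_{j+1,j}$ is the $(j+1)\times j$ tridiagonal matrix whose column $k$ has entries $\bar\delta_{k-1}$ in row $k-1$ (if $k\ge1$), $\bar\gamma_k$ in row $k$, $\bar\delta_k$ in row $k+1$; $\bar H_{j,j}$ consists of its first $j$ rows. $\bar\Delta_{j+1,j}$ is the $(j+1)\times j$ matrix with entry $\bar\delta_k$ in position $(k+1,k)$, $0\le k\le j-1$, and zeros elsewhere. The scalars of the LU factorization satisfy $\bar\eta_0=\bar\gamma_0$, $\bar\lambda_k=\bar\delta_{k-1}/\bar\eta_{k-1}$, $\bar\eta_k=\bar\gamma_k-\bar\lambda_k\bar\delta_{k-1}$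 for $1\le k\le j-1$, all $\bar\eta_k\ne0$, so that $\bar H_{j,j}=\bar L_j\bar U_j$ with $\bar L_j$ unit lower bidiagonal with subdiagonal entries $\bar\lambda_1,\dots,\bar\lambda_{j-1}$ and $\bar U_j$ upper bidiagonal with diagonal $\bar\eta_0,\dots,\bar\eta_{j-1}$ and superdiagonal $\bar\delta_0,\dots,\bar\delta_{j-2}$. Further $\bar\zeta_0=\|\bar r_0\|$ and $\bar\zeta_k=-\bar\lambda_k\bar\zeta_{k-1}$ for $1\le k\le j-1$. The computed search directions and approximate solutions satisfy, exactly, with local rounding errors $\xi$: $$\bar p_k=(\bar v_k-\bar\delta_{k-1}\bar p_{k-1})/\bar\eta_k+\xi^{\bar p}_k\quad(0\le k\le j-1),\qquad \bar x_k=\bar x_{k-1}+\bar\zeta_{k-1}\bar p_{k-1}+\xi^{\bar x}_k\quad(1\le k\le j).$$ Finally $\Theta^{\bar p}_j=-[\bar\eta_0\xi^{\bar p}_0,\dots,\bar\eta_{j-1}\xi^{\bar p}_{j-1}]$ and $\Theta^{\bar x}_j=[\xi^{\bar x}_1,\dots,\xi^{\bar x}_j]$. *)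

theory Defs
  imports Complex_Main "Jordan_Normal_Form.Gauss_Jordan_Elimination"
begin

definition eucl_norm :: "real vec \<Rightarrow> real" where
  "eucl_norm u = sqrt (u \<bullet> u)"

(* Terms with a negative index are zero: v (-1) drops out of the second clause. *)
fun true_basis ::
  "real mat \<Rightarrow> (nat \<Rightarrow> real vec) \<Rightarrow> (nat \<Rightarrow> real) \<Rightarrow> (nat \<Rightarrow> real) \<Rightarrow> nat \<Rightarrow> real vec" where
  "true_basis A v \<gamma> \<delta> 0 = v 0"
| "true_basis A v \<gamma> \<delta> (Suc 0) = (1 / \<delta> 0) \<cdot>\<^sub>v (A *\<^sub>v v 0 - \<gamma> 0 \<cdot>\<^sub>v v 0)"
| "true_basis A v \<gamma> \<delta> (Suc (Suc k)) =
     (1 / \<delta> (Suc k)) \<cdot>\<^sub>v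
       (A *\<^sub>v v (Suc k) - \<gamma> (Suc k) \<cdot>\<^sub>v v (Suc k) - \<delta> k \<cdot>\<^sub>v v k)"

definition basis_mat :: "nat \<Rightarrow> (nat \<Rightarrow> real vec) \<Rightarrow> nat \<Rightarrow> real mat" where
  "basis_mat n v m = mat_of_cols n (map v [0..<m])"

(* m = j + 1 gives H_(j+1,j), and m = j its first j rows H_(j,j). *)
definition tridiag :: "(nat \<Rightarrow> real) \<Rightarrow> (nat \<Rightarrow> real) \<Rightarrow> nat \<Rightarrow> nat \<Rightarrow> real mat" where
  "tridiag \<gamma> \<delta> m j = mat m j (\<lambda>(i, k).
     if i + 1 = k then \<delta> i
     else if i = k then \<gamma> k
     else if i = k + 1 then \<delta> k
     else 0)"

definition Delta_mat :: "(nat \<Rightarrow> real) \<Rightarrow> nat \<Rightarrow> real mat" where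
  "Delta_mat \<delta> j = mat (j + 1) j (\<lambda>(i, k). if i = k + 1 then \<delta> k else 0)"

definition Theta_p :: "nat \<Rightarrow> (nat \<Rightarrow> real) \<Rightarrow> (nat \<Rightarrow> real vec) \<Rightarrow> nat \<Rightarrow> real mat" where
  "Theta_p n \<eta> \<xi>p j = - mat_of_cols n (map (\<lambda>k. \<eta> k \<cdot>\<^sub>v \<xi>p k) [0..<j])"

definition Theta_x :: "nat \<Rightarrow> (nat \<Rightarrow> real vec) \<Rightarrow> nat \<Rightarrow> real mat" where
  "Theta_x n \<xi>x j = mat_of_cols n (map \<xi>x [1..<j + 1])"

(* Unspecified for singular M, where mat_inverse M = None. *)
definition inv_mat :: "real mat \<Rightarrow> real mat" where
  "inv_mat M = the (mat_inverse M)"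

definition ones_vec :: "nat \<Rightarrow> real vec" where
  "ones_vec j = vec j (\<lambda>_. 1)"

end

(* Column k of the recurrence for p says P U = V_j - Theta^p, and L (U y) = |r_0| e_1 forces
   U y = zeta, so P zeta = V_j y - Theta^p y, which turns the sum of the recurrence for x into
   x_j = x_0 + V_j y - Theta^p y + Theta^x 1.  The definition of the true basis gives
   A V_j = V_(j+1) H_(j+1,j) + (true V_(j+1) - V_(j+1)) Delta_(j+1,j). *)
theory Submission
  imports Defs "Jordan_Normal_Form.Determinant"
begin

(* Superdiagonal entries are indexed by their row, the others by their column. *)
definition tridiag_of :: "(nat \<Rightarrow> real) \<Rightarrow> (nat \<Rightarrow> real) \<Rightarrow> (nat \<Rightarrow> real) \<Rightarrow> nat \<Rightarrow> nat \<Rightarrow> real mat" where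
  "tridiag_of a d c m j = mat m j (\<lambda>(i, k).
     if i + 1 = k then a i
     else if i = k then d k
     else if i = k + 1 then c k
     else 0)"

lemma tridiag_of_carrier [simp]: "tridiag_of a d c m j \<in> carrier_mat m j"
  by (simp add: tridiag_of_def)

lemma tridiag_of_dims [simp]:
  "dim_row (tridiag_of a d c m j) = m" "dim_col (tridiag_of a d c m j) = j"
  by (simp_all add: tridiag_of_def)

lemma tridiag_eq_tridiag_of: "tridiag \<gamma> \<delta> m j = tridiag_of \<delta> \<gamma> \<delta> m j"
  by (simp add: tridiag_def tridiag_of_def)

text \<open>With \<open>Delta_mat\<close> in this form, one entry formula serves products with H,
  \<Delta> and both LU factors.\<close>

lemma Delta_mat_eq_tridiag_of: "Delta_mat \<delta> j = tridiag_of (\<lambda>_. 0) (\<lambda>_. 0) \<delta> (j + 1) j"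
  by (auto simp: Delta_mat_def tridiag_of_def intro!: cong_mat)

section \<open>Entries of products with tridiagonal matrices\<close>

text \<open>At most three terms survive. The same sum occurs for a column of a tridiagonal matrix as
  for a row, so products from either side reduce to it.\<close>

lemma sum_tridiagonal:
  fixes f a :: "nat \<Rightarrow> real"
  assumes "k < m"
  shows "(\<Sum>l<m. f l * (if l + 1 = k then a l else if l = k then d else if l = k + 1 then c else 0)) =
    (if k = 0 then 0 else f (k - 1) * a (k - 1)) + f k * d + (if k + 1 < m then f (k + 1) * c else 0)"
proof -
  \<comment> \<open>The three conditions exclude each other, so the sum splits. For
    \<open>k = 0\<close> the truncated \<open>k - 1\<close> is again 0, and the inner test on
    \<open>k\<close> removes this spurious term.\<close>
  have "(\<Sum>l<m. f l * (if l + 1 = k then a l else if l = k then d else if l = k + 1 then c else 0)) =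
    (\<Sum>l<m. (if l = k - 1 then if k = 0 then 0 else f l * a l else 0)
       + (if l = k then f l * d else 0) + (if l = k + 1 then f l * c else 0))"
    by (rule sum.cong) auto
  also have "\<dots> = (if k = 0 then 0 else f (k - 1) * a (k - 1)) + f k * d
      + (if k + 1 < m then f (k + 1) * c else 0)"
    using assms by (simp add: sum.distrib less_imp_diff_less)
  finally show ?thesis .
qed

lemma mult_tridiag_of_index:
  assumes "M \<in> carrier_mat n m" "i < n" "k < j" "k < m"
  shows "(M * tridiag_of a d c m j) $$ (i, k) =
    (if k = 0 then 0 else M $$ (i, k - 1) * a (k - 1)) + M $$ (i, k) * d k
      + (if k + 1 < m then M $$ (i, k + 1) * c k else 0)"
proof -
  have "(M * tridiag_of a d c m j) $$ (i, k) = (\<Sum>l<m. M $$ (i, l) *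
      (if l + 1 = k then a l else if l = k then d k else if l = k + 1 then c k else 0))"
    using assms by (auto simp: scalar_prod_def tridiag_of_def atLeast0LessThan intro!: sum.cong)
  then show ?thesis using sum_tridiagonal[OF \<open>k < m\<close>] by simp
qed

lemma tridiag_of_mult_vec_index:
  assumes "w \<in> carrier_vec m" "i < j" "i < m"
  shows "(tridiag_of a d c j m *\<^sub>v w) $ i =
    (if i = 0 then 0 else w $ (i - 1) * c (i - 1)) + w $ i * d i
      + (if i + 1 < m then w $ (i + 1) * a i else 0)"
proof -
  \<comment> \<open>Read along row \<open>i\<close>, the entry left of the diagonal comes from
    \<open>c\<close> and is indexed by its column, the one to the right is the fixed value
    \<open>a i\<close>: \<open>a\<close> and \<open>c\<close> exchange the roles they have along a
    column.\<close>
  have "(tridiag_of a d c j m *\<^sub>v w) $ i = (\<Sum>l<m. w $ l *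
      (if l + 1 = i then c l else if l = i then d i else if l = i + 1 then a i else 0))"
    using assms by (auto simp: scalar_prod_def tridiag_of_def atLeast0LessThan intro!: sum.cong)
  then show ?thesis using sum_tridiagonal[OF \<open>i < m\<close>] by simp
qed

section \<open>Matrices given by their columns\<close>

lemma basis_mat_carrier [simp]: "basis_mat n f m \<in> carrier_mat n m"
  by (simp add: basis_mat_def carrier_matI)

lemma basis_mat_dims [simp]: "dim_row (basis_mat n f m) = n" "dim_col (basis_mat n f m) = m"
  by (simp_all add: basis_mat_def)

lemma basis_mat_index [simp]: "i < n \<Longrightarrow> k < m \<Longrightarrow> basis_mat n f m $$ (i, k) = f k $ i"
  by (simp add: basis_mat_def mat_of_cols_index)

lemma basis_mat_mult_vec_index:
  "w \<in> carrier_vec m \<Longrightarrow> i < n \<Longrightarrow> (basis_mat n f m *\<^sub>v w) $ i = (\<Sum>l<m. f l $ i * w $ l)"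
  by (auto simp: scalar_prod_def atLeast0LessThan basis_mat_def mat_of_cols_index intro!: sum.cong)

lemma mult_basis_mat_index:
  assumes "A \<in> carrier_mat n n" "i < n" "k < m" "f k \<in> carrier_vec n"
  shows "(A * basis_mat n f m) $$ (i, k) = (A *\<^sub>v f k) $ i"
  using assms by (simp add: basis_mat_def col_mat_of_cols)

text \<open>The errors of the iterates are numbered from 1, columns from 0. The shift makes the
  facts on \<open>basis_mat\<close> available.\<close>

lemma Theta_x_eq: "Theta_x n \<xi>x j = basis_mat n (\<lambda>k. \<xi>x (Suc k)) j"
proof -
  have "map \<xi>x [1..<j + 1] = map (\<lambda>k. \<xi>x (Suc k)) [0..<j]"
    by (rule nth_equalityI) (auto simp del: upt_Suc)
  then show ?thesis by (simp only: Theta_x_def basis_mat_def)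
qed

section \<open>LU factorization and the projected system\<close>

text \<open>Column \<open>k\<close> of the product mixes columns \<open>k - 1\<close> and
  \<open>k\<close> of the lower factor. Its entries are \<delta> above the diagonal,
  \<open>lam k * \<delta> (k - 1) + \<eta> k = \<gamma> k\<close> on it, and
  \<open>lam (k + 1) * \<eta> k = \<delta> k\<close> below it. The \<open>Suc\<close> is there
  because \<open>lam\<close> is numbered by rows, the subdiagonal of \<open>tridiag_of\<close> by
  columns.\<close>

lemma tridiag_LU:
  assumes "\<eta> 0 = \<gamma> 0"
    and "\<And>k. 1 \<le> k \<Longrightarrow> k < j \<Longrightarrow> lam k = \<delta> (k - 1) / \<eta> (k - 1)"
    and "\<And>k. 1 \<le> k \<Longrightarrow> k < j \<Longrightarrow> \<eta> k = \<gamma> k - lam k * \<delta> (k - 1)"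
    and "\<And>k. k < j \<Longrightarrow> \<eta> k \<noteq> 0"
  shows "tridiag \<gamma> \<delta> j j =
    tridiag_of (\<lambda>_. 0) (\<lambda>_. 1) (\<lambda>k. lam (Suc k)) j j * tridiag_of \<delta> \<eta> (\<lambda>_. 0) j j"
    (is "_ = ?L * ?U")
proof (rule eq_matI)
  fix i k assume "i < dim_row (?L * ?U)" "k < dim_col (?L * ?U)"
  then have ik: "i < j" "k < j" by auto
  have "(?L * ?U) $$ (i, k) =
      (if k = 0 then 0 else ?L $$ (i, k - 1) * \<delta> (k - 1)) + ?L $$ (i, k) * \<eta> k"
    using mult_tridiag_of_index[of ?L j j i k j] ik by simp
  moreover have "\<eta> k = \<gamma> k - lam k * \<delta> (k - 1)" if "k > 0"
    using assms(3)[of k] that ik by simp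
  moreover have "lam i * \<eta> k = \<delta> k" if "i = Suc k"
    using assms(2)[of i] assms(4)[of k] that ik by simp
  ultimately show "tridiag \<gamma> \<delta> j j $$ (i, k) = (?L * ?U) $$ (i, k)"
    using ik assms(1) by (cases "k = 0") (auto simp: tridiag_def tridiag_of_def)
qed (simp_all add: tridiag_def)

text \<open>Serves twice: to cancel the lower factor, and to reduce the determinant of H to the
  product of the \<eta>.\<close>

lemma det_unit_lower_bidiagonal:
  "det (tridiag_of (\<lambda>_. 0) (\<lambda>_. 1) c j j) = 1"
proof -
  have "det (tridiag_of (\<lambda>_. 0) (\<lambda>_. 1) c j j)
      = prod_list (diag_mat (tridiag_of (\<lambda>_. 0) (\<lambda>_. 1) c j j))"
    by (rule det_lower_triangular[of j]) (auto simp: tridiag_of_def)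
  also have "\<dots> = 1"
    unfolding prod_list_diag_prod by (auto simp: tridiag_of_def)
  finally show ?thesis .
qed

lemma det_upper_bidiagonal:
  "det (tridiag_of a d (\<lambda>_. 0) j j) = (\<Prod>k<j. d k)"
proof -
  have "det (tridiag_of a d (\<lambda>_. 0) j j) = prod_list (diag_mat (tridiag_of a d (\<lambda>_. 0) j j))"
    by (rule det_upper_triangular[of _ j]) (auto simp: tridiag_of_def)
  also have "\<dots> = (\<Prod>k<j. d k)"
    unfolding prod_list_diag_prod by (auto simp: tridiag_of_def atLeast0LessThan)
  finally show ?thesis .
qed

text \<open>A nonzero determinant makes \<open>M\<close> a unit of the matrix ring, so
  \<open>mat_inverse M\<close> is not \<open>None\<close> and \<open>inv_mat M\<close> is a genuine
  inverse.\<close>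

lemma inv_mat_solves:
  assumes M: "M \<in> carrier_mat m m" and "det M \<noteq> 0" and w: "w \<in> carrier_vec m"
  shows "inv_mat M *\<^sub>v w \<in> carrier_vec m" "M *\<^sub>v (inv_mat M *\<^sub>v w) = w"
proof -
  from det_non_zero_imp_unit[OF M \<open>det M \<noteq> 0\<close>, of "()"] mat_inverse(1)[OF M, of "()"]
  obtain N where N: "mat_inverse M = Some N" by (cases "mat_inverse M") auto
  with mat_inverse(2)[OF M N] have "inv_mat M \<in> carrier_mat m m" "M * inv_mat M = 1\<^sub>m m"
    by (auto simp: inv_mat_def)
  then show "inv_mat M *\<^sub>v w \<in> carrier_vec m" "M *\<^sub>v (inv_mat M *\<^sub>v w) = w"
    using assoc_mult_mat_vec[of M m m "inv_mat M" m w] M w by auto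
qed

lemma mult_vec_cancel_left:
  fixes M :: "real mat"
  assumes M: "M \<in> carrier_mat m m" and "det M \<noteq> 0"
    and uw: "u \<in> carrier_vec m" "w \<in> carrier_vec m" and eq: "M *\<^sub>v u = M *\<^sub>v w"
  shows "u = w"
proof -
  obtain N where N: "N \<in> carrier_mat m m" "N * M = 1\<^sub>m m"
    using det_non_zero_imp_unit[OF M \<open>det M \<noteq> 0\<close>, of "()"]
    by (auto simp: Units_def ring_mat_def)
  have "(N * M) *\<^sub>v u = (N * M) *\<^sub>v w"
    using assoc_mult_mat_vec[OF N(1) M] uw eq by metis
  then show ?thesis using N uw by simp
qed

text \<open>The recursion for \<zeta> is forward substitution in the lower bidiagonal system with
  right-hand side c times the first unit vector. That factor has determinant 1, so the solution is
  unique.\<close>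

lemma upper_factor_solution:
  assumes "j \<ge> 1" "y \<in> carrier_vec j"
    and "tridiag_of (\<lambda>_. 0) (\<lambda>_. 1) (\<lambda>k. lam (Suc k)) j j *\<^sub>v (U *\<^sub>v y) = c \<cdot>\<^sub>v unit_vec j 0"
    and "U \<in> carrier_mat j j"
    and "\<zeta> 0 = c" "\<And>k. 1 \<le> k \<Longrightarrow> k < j \<Longrightarrow> \<zeta> k = - lam k * \<zeta> (k - 1)"
  shows "U *\<^sub>v y = vec j \<zeta>"
proof -
  let ?L = "tridiag_of (\<lambda>_. 0) (\<lambda>_. 1) (\<lambda>k. lam (Suc k)) j j"
  have "?L *\<^sub>v vec j \<zeta> = c \<cdot>\<^sub>v unit_vec j 0"
  proof (rule eq_vecI)
    fix i assume "i < dim_vec (c \<cdot>\<^sub>v unit_vec j 0)"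
    then have i: "i < j" by simp
    \<comment> \<open>Row \<open>i > 0\<close> reads
      \<open>lam i * \<zeta> (i - 1) + \<zeta> i\<close>, which the recursion makes zero; row 0 is
      \<open>\<zeta> 0 = c\<close>.\<close>
    show "(?L *\<^sub>v vec j \<zeta>) $ i = (c \<cdot>\<^sub>v unit_vec j 0) $ i"
      using i assms(5) assms(6)[of i] by (cases "i = 0") (simp_all add: tridiag_of_mult_vec_index del: index_mult_mat_vec)
  qed simp
  then show ?thesis
    using mult_vec_cancel_left[of ?L j "U *\<^sub>v y" "vec j \<zeta>"] assms det_unit_lower_bidiagonal
    by simp
qed

section \<open>The recurrences in matrix form\<close>

text \<open>Clearing the denominator in the definition of the true basis gives an exact three-term
  recurrence for \<open>A *\<^sub>v v k\<close> whose last vector is the true one. The product with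
  H has the computed vector there; the \<Delta> term exchanges it.\<close>

lemma mult_basis_mat_true_basis:
  assumes A: "A \<in> carrier_mat n n"
    and v: "\<And>k. k \<le> j \<Longrightarrow> v k \<in> carrier_vec n"
    and \<delta>: "\<And>k. k < j \<Longrightarrow> \<delta> k \<noteq> 0"
  shows "A * basis_mat n v j = basis_mat n v (j + 1) * tridiag \<gamma> \<delta> (j + 1) j
    + (basis_mat n (true_basis A v \<gamma> \<delta>) (j + 1) - basis_mat n v (j + 1)) * Delta_mat \<delta> j"
    (is "_ = ?V * ?H + (?T - ?V) * ?D")
proof (rule eq_matI)
  fix i k assume "i < dim_row (?V * ?H + (?T - ?V) * ?D)" "k < dim_col (?V * ?H + (?T - ?V) * ?D)"
  then have ik: "i < n" "k < j" by (auto simp: Delta_mat_def basis_mat_def)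
  have c: "?V \<in> carrier_mat n (j + 1)" "?T - ?V \<in> carrier_mat n (j + 1)"
    using basis_mat_carrier by (auto simp del: basis_mat_carrier intro!: minus_carrier_mat)
  have lhs: "(A * basis_mat n v j) $$ (i, k) = (A *\<^sub>v v k) $ i"
    using mult_basis_mat_index[OF A] ik v by simp
  have VH: "(?V * ?H) $$ (i, k) = (if k = 0 then 0 else v (k - 1) $ i * \<delta> (k - 1))
      + v k $ i * \<gamma> k + v (k + 1) $ i * \<delta> k"
    using mult_tridiag_of_index[OF c(1), of i k j] ik by (simp add: tridiag_eq_tridiag_of)
  have TD: "((?T - ?V) * ?D) $$ (i, k) = (true_basis A v \<gamma> \<delta> (k + 1) $ i - v (k + 1) $ i) * \<delta> k"
  proof -
    have "((?T - ?V) * ?D) $$ (i, k) = (?T - ?V) $$ (i, k + 1) * \<delta> k"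
      using mult_tridiag_of_index[OF c(2), of i k j] ik by (simp add: Delta_mat_eq_tridiag_of)
    also have "(?T - ?V) $$ (i, k + 1) = ?T $$ (i, k + 1) - ?V $$ (i, k + 1)"
      using ik c(1) by (intro index_minus_mat) (auto simp: carrier_matD)
    finally show ?thesis using ik by simp
  qed
  \<comment> \<open>The cases match the clauses of \<open>true_basis\<close>: at
    \<open>k = 0\<close> there is no previous vector.\<close>
  have t: "true_basis A v \<gamma> \<delta> (k + 1) $ i * \<delta> k = (A *\<^sub>v v k) $ i - \<gamma> k * v k $ i
      - (if k = 0 then 0 else \<delta> (k - 1) * v (k - 1) $ i)"
  proof (cases k)
    case 0
    have "dim_vec (v 0) = n" using v[of 0] by auto
    then show ?thesis using 0 \<delta>[of k] ik A by simp
  next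
    case (Suc l)
    have "dim_vec (v l) = n" "dim_vec (v k) = n" using v[of l] v[of k] ik Suc by auto
    then show ?thesis using Suc \<delta>[of k] ik A by simp
  qed
  show "(A * basis_mat n v j) $$ (i, k) = (?V * ?H + (?T - ?V) * ?D) $$ (i, k)"
  proof -
    have "(?V * ?H + (?T - ?V) * ?D) $$ (i, k) = (?V * ?H) $$ (i, k) + ((?T - ?V) * ?D) $$ (i, k)"
      using ik by (intro index_add_mat) (auto simp: Delta_mat_def basis_mat_def)
    then show ?thesis
      unfolding lhs VH TD using t by (cases "k = 0") (simp_all add: algebra_simps)
  qed
qed (use A in \<open>auto simp: Delta_mat_def basis_mat_def\<close>)

text \<open>Multiplying the recurrence for \<open>p k\<close> by \<open>\<eta> k\<close> and moving
  the earlier direction to the left gives column \<open>k\<close>. The sign built into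
  \<open>Theta_p\<close> turns the added error into a subtracted matrix.\<close>

lemma direction_mat_mult_upper_factor:
  assumes v: "\<And>k. k < j \<Longrightarrow> v k \<in> carrier_vec n"
    and p: "\<And>k. k < j \<Longrightarrow> p k \<in> carrier_vec n"
    and \<xi>: "\<And>k. k < j \<Longrightarrow> \<xi>p k \<in> carrier_vec n"
    and \<eta>: "\<And>k. k < j \<Longrightarrow> \<eta> k \<noteq> 0"
    and p_0: "p 0 = (1 / \<eta> 0) \<cdot>\<^sub>v v 0 + \<xi>p 0"
    and p_k: "\<And>k. 1 \<le> k \<Longrightarrow> k < j \<Longrightarrow>
           p k = (1 / \<eta> k) \<cdot>\<^sub>v (v k - \<delta> (k - 1) \<cdot>\<^sub>v p (k - 1)) + \<xi>p k"
  shows "basis_mat n p j * tridiag_of \<delta> \<eta> (\<lambda>_. 0) j j = basis_mat n v j - Theta_p n \<eta> \<xi>p j"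
proof (rule eq_matI)
  fix i k assume "i < dim_row (basis_mat n v j - Theta_p n \<eta> \<xi>p j)"
    "k < dim_col (basis_mat n v j - Theta_p n \<eta> \<xi>p j)"
  then have ik: "i < n" "k < j" by (auto simp: Theta_p_def)
  have dims: "dim_vec (v k) = n" "dim_vec (\<xi>p k) = n" using v \<xi> ik by auto
  have "(if k = 0 then 0 else p (k - 1) $ i * \<delta> (k - 1)) + p k $ i * \<eta> k
      = v k $ i + \<eta> k * \<xi>p k $ i"
  proof (cases "k = 0")
    case True
    then have "p k $ i = v k $ i / \<eta> k + \<xi>p k $ i" using p_0 dims ik by simp
    then show ?thesis using True \<eta>[OF ik(2)] by (simp add: field_simps)
  next
    case False
    then have "dim_vec (p (k - 1)) = n" using p[of "k - 1"] ik by auto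
    then have "p k $ i = (v k $ i - \<delta> (k - 1) * p (k - 1) $ i) / \<eta> k + \<xi>p k $ i"
      using p_k[of k] False dims ik by simp
    then show ?thesis using False \<eta>[OF ik(2)] by (simp add: field_simps)
  qed
  moreover have "(basis_mat n v j - Theta_p n \<eta> \<xi>p j) $$ (i, k) = v k $ i + \<eta> k * \<xi>p k $ i"
    using ik dims by (simp add: Theta_p_def basis_mat_def mat_of_cols_index)
  ultimately show "(basis_mat n p j * tridiag_of \<delta> \<eta> (\<lambda>_. 0) j j) $$ (i, k)
      = (basis_mat n v j - Theta_p n \<eta> \<xi>p j) $$ (i, k)"
    using mult_tridiag_of_index[of "basis_mat n p j" n j i k j] ik by (cases "k = 0") simp_all
qed (auto simp: Theta_p_def basis_mat_def)

lemma iterate_eq_sum: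
  assumes x: "\<And>k. k \<le> j \<Longrightarrow> x k \<in> carrier_vec n"
    and p: "\<And>k. k < j \<Longrightarrow> p k \<in> carrier_vec n"
    and \<xi>: "\<And>k. 1 \<le> k \<Longrightarrow> k \<le> j \<Longrightarrow> \<xi>x k \<in> carrier_vec n"
    and x_k: "\<And>k. 1 \<le> k \<Longrightarrow> k \<le> j \<Longrightarrow>
           x k = x (k - 1) + \<zeta> (k - 1) \<cdot>\<^sub>v p (k - 1) + \<xi>x k"
  shows "x j = x 0 + basis_mat n p j *\<^sub>v vec j \<zeta> + Theta_x n \<xi>x j *\<^sub>v ones_vec j"
proof (rule eq_vecI)
  have d: "dim_row (basis_mat n p j) = n" "dim_row (Theta_x n \<xi>x j) = n"
    by (simp_all add: basis_mat_def Theta_x_def)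
  show "dim_vec (x j) = dim_vec (x 0 + basis_mat n p j *\<^sub>v vec j \<zeta> + Theta_x n \<xi>x j *\<^sub>v ones_vec j)"
    using x[of j] d by simp
  fix i assume "i < dim_vec (x 0 + basis_mat n p j *\<^sub>v vec j \<zeta> + Theta_x n \<xi>x j *\<^sub>v ones_vec j)"
  then have i: "i < n" using d by simp
  \<comment> \<open>The matrices have the fixed width \<open>j\<close>, so the induction runs on
    partial sums for every \<open>k\<close> up to \<open>j\<close>.\<close>
  have "x k $ i = x 0 $ i + (\<Sum>l<k. p l $ i * \<zeta> l) + (\<Sum>l<k. \<xi>x (Suc l) $ i)" if "k \<le> j" for k
    using that
  proof (induction k)
    case (Suc k)
    have "x (Suc k) = x k + \<zeta> k \<cdot>\<^sub>v p k + \<xi>x (Suc k)" using x_k[of "Suc k"] Suc.prems by simp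
    moreover have "dim_vec (x k) = n" "dim_vec (p k) = n" "dim_vec (\<xi>x (Suc k)) = n"
      using x[of k] p[of k] \<xi>[of "Suc k"] Suc.prems by auto
    ultimately show ?case using Suc i by simp
  qed simp
  from this[of j]
  show "x j $ i = (x 0 + basis_mat n p j *\<^sub>v vec j \<zeta> + Theta_x n \<xi>x j *\<^sub>v ones_vec j) $ i"
    using i d by (simp add: basis_mat_mult_vec_index Theta_x_eq ones_vec_def
        del: index_mult_mat_vec)
qed

section \<open>The gap between true and computed residual\<close>

theorem mainTheorem2:
  fixes n j :: nat
    and A :: "real mat" and b :: "real vec"
    and x p v \<xi>x \<xi>p :: "nat \<Rightarrow> real vec"
    and \<gamma> \<delta> \<eta> lam \<zeta> :: "nat \<Rightarrow> real"
    and r0 y r r_true :: "real vec"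
  assumes j: "j \<ge> 1"
    and A: "A \<in> carrier_mat n n"
    and b: "b \<in> carrier_vec n"
    and v_dim: "\<And>k. k \<le> j \<Longrightarrow> v k \<in> carrier_vec n"
    and p_dim: "\<And>k. k < j \<Longrightarrow> p k \<in> carrier_vec n"
    and x_dim: "\<And>k. k \<le> j \<Longrightarrow> x k \<in> carrier_vec n"
    and \<xi>p_dim: "\<And>k. k < j \<Longrightarrow> \<xi>p k \<in> carrier_vec n"
    and \<xi>x_dim: "\<And>k. 1 \<le> k \<Longrightarrow> k \<le> j \<Longrightarrow> \<xi>x k \<in> carrier_vec n"
    and \<delta>_nz: "\<And>k. k < j \<Longrightarrow> \<delta> k \<noteq> 0"
    and \<eta>_0: "\<eta> 0 = \<gamma> 0"
    and lam_k: "\<And>k. 1 \<le> k \<Longrightarrow> k < j \<Longrightarrow> lam k = \<delta> (k - 1) / \<eta> (k - 1)"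
    and \<eta>_k: "\<And>k. 1 \<le> k \<Longrightarrow> k < j \<Longrightarrow> \<eta> k = \<gamma> k - lam k * \<delta> (k - 1)"
    and \<eta>_nz: "\<And>k. k < j \<Longrightarrow> \<eta> k \<noteq> 0"
    and r0: "r0 = b - A *\<^sub>v x 0"
    and \<zeta>_0: "\<zeta> 0 = eucl_norm r0"
    and \<zeta>_k: "\<And>k. 1 \<le> k \<Longrightarrow> k < j \<Longrightarrow> \<zeta> k = - lam k * \<zeta> (k - 1)"
    and p_0: "p 0 = (1 / \<eta> 0) \<cdot>\<^sub>v v 0 + \<xi>p 0"
    and p_k: "\<And>k. 1 \<le> k \<Longrightarrow> k < j \<Longrightarrow>
           p k = (1 / \<eta> k) \<cdot>\<^sub>v (v k - \<delta> (k - 1) \<cdot>\<^sub>v p (k - 1)) + \<xi>p k"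
    and x_k: "\<And>k. 1 \<le> k \<Longrightarrow> k \<le> j \<Longrightarrow>
           x k = x (k - 1) + \<zeta> (k - 1) \<cdot>\<^sub>v p (k - 1) + \<xi>x k"
    and y: "y = inv_mat (tridiag \<gamma> \<delta> j j) *\<^sub>v (eucl_norm r0 \<cdot>\<^sub>v unit_vec j 0)"
    and r_true: "r_true = b - A *\<^sub>v x j"
    and r: "r = r0 - (basis_mat n v (j + 1) * tridiag \<gamma> \<delta> (j + 1) j) *\<^sub>v y"
  shows "r_true =
    r - ((basis_mat n (true_basis A v \<gamma> \<delta>) (j + 1) - basis_mat n v (j + 1)) * Delta_mat \<delta> j) *\<^sub>v y
      + (A * Theta_p n \<eta> \<xi>p j) *\<^sub>v y
      - (A * Theta_x n \<xi>x j) *\<^sub>v ones_vec j"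
proof -
  let ?H = "tridiag \<gamma> \<delta> j j" and ?L = "tridiag_of (\<lambda>_. 0) (\<lambda>_. 1) (\<lambda>k. lam (Suc k)) j j"
    and ?U = "tridiag_of \<delta> \<eta> (\<lambda>_. 0) j j"
  define V where "V = basis_mat n v j"
  define VH where "VH = basis_mat n v (j + 1) * tridiag \<gamma> \<delta> (j + 1) j"
  define D where "D = (basis_mat n (true_basis A v \<gamma> \<delta>) (j + 1) - basis_mat n v (j + 1))
      * Delta_mat \<delta> j"
  define P where "P = basis_mat n p j"
  define Tp where "Tp = Theta_p n \<eta> \<xi>p j"
  define Tx where "Tx = Theta_x n \<xi>x j"
  have carr [simp]: "V \<in> carrier_mat n j" "P \<in> carrier_mat n j" "Tp \<in> carrier_mat n j"
    "Tx \<in> carrier_mat n j" "VH \<in> carrier_mat n j" "D \<in> carrier_mat n j"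
    "ones_vec j \<in> carrier_vec j"
    unfolding V_def P_def Tp_def Tx_def VH_def D_def
    by (auto simp: basis_mat_def Theta_p_def Theta_x_eq Delta_mat_def tridiag_def ones_vec_def
        intro!: carrier_matI)
  note [simp] = A b

  have LU: "?H = ?L * ?U" using tridiag_LU \<eta>_0 lam_k \<eta>_k \<eta>_nz by blast
  \<comment> \<open>The determinant is the product of the \<eta>; hence \<open>y\<close> really
    solves the projected system.\<close>
  have "det ?H \<noteq> 0"
    unfolding LU using \<eta>_nz
    by (simp add: det_mult[of _ j] det_unit_lower_bidiagonal det_upper_bidiagonal)
  then have y_dim [simp]: "y \<in> carrier_vec j" and Hy: "?H *\<^sub>v y = eucl_norm r0 \<cdot>\<^sub>v unit_vec j 0"
    using inv_mat_solves[of ?H j "eucl_norm r0 \<cdot>\<^sub>v unit_vec j 0"]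
    unfolding y by (auto simp: tridiag_eq_tridiag_of)
  have "?L *\<^sub>v (?U *\<^sub>v y) = eucl_norm r0 \<cdot>\<^sub>v unit_vec j 0"
    using Hy unfolding LU by (simp add: assoc_mult_mat_vec[of _ j j _ j])
  then have Uy: "?U *\<^sub>v y = vec j \<zeta>"
    using upper_factor_solution[of j y lam ?U] j \<zeta>_0 \<zeta>_k by simp

  have PU: "P * ?U = V - Tp"
    unfolding P_def V_def Tp_def
    by (rule direction_mat_mult_upper_factor) (use v_dim p_dim \<xi>p_dim \<eta>_nz p_0 p_k in auto)
  \<comment> \<open>Replacing \<zeta> by U y removes the search directions from the iterate and
    leaves only basis vectors and local errors.\<close>
  have "P *\<^sub>v vec j \<zeta> = (P * ?U) *\<^sub>v y"
    unfolding Uy[symmetric] by (simp add: assoc_mult_mat_vec[of _ n j _ j])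
  also have "\<dots> = V *\<^sub>v y - Tp *\<^sub>v y"
    unfolding PU by (rule minus_mult_distrib_mat_vec[of _ n j]) simp_all
  finally have P\<zeta>: "P *\<^sub>v vec j \<zeta> = V *\<^sub>v y - Tp *\<^sub>v y" .
  have xj: "x j = x 0 + (V *\<^sub>v y - Tp *\<^sub>v y) + Tx *\<^sub>v ones_vec j"
    using iterate_eq_sum[of j x n p \<xi>x \<zeta>] x_dim p_dim \<xi>x_dim x_k
    unfolding P\<zeta>[symmetric] P_def Tx_def by blast

  \<comment> \<open>Here the deviation of the computed basis from the true one enters, through
    \<open>D\<close>.\<close>
  have "A *\<^sub>v (V *\<^sub>v y) = (VH + D) *\<^sub>v y"
    using mult_basis_mat_true_basis[of A n j v \<delta> \<gamma>] v_dim \<delta>_nz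
    unfolding V_def[symmetric] VH_def[symmetric] D_def[symmetric]
    by (simp add: assoc_mult_mat_vec[of _ n n _ j, symmetric])
  also have "\<dots> = VH *\<^sub>v y + D *\<^sub>v y"
    by (rule add_mult_distrib_mat_vec[of _ n j]) simp_all
  finally have AVy: "A *\<^sub>v (V *\<^sub>v y) = VH *\<^sub>v y + D *\<^sub>v y" .

  have x0: "x 0 \<in> carrier_vec n" using x_dim by simp
  have c: "V *\<^sub>v y \<in> carrier_vec n" "Tp *\<^sub>v y \<in> carrier_vec n" "Tx *\<^sub>v ones_vec j \<in> carrier_vec n"
    by (auto intro!: mult_mat_vec_carrier[of _ n j])
  have "A *\<^sub>v x j = A *\<^sub>v x 0 + (A *\<^sub>v (V *\<^sub>v y) - A *\<^sub>v (Tp *\<^sub>v y)) + A *\<^sub>v (Tx *\<^sub>v ones_vec j)"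
    unfolding xj using x0 c A
    by (simp add: mult_add_distrib_mat_vec[of _ n n] mult_minus_distrib_mat_vec[of _ n n]
        assoc_add_vec[of _ n] mult_mat_vec_carrier[OF A] minus_carrier_vec)
  then have Ax: "A *\<^sub>v x j = A *\<^sub>v x 0 + (VH *\<^sub>v y + D *\<^sub>v y - (A * Tp) *\<^sub>v y) + (A * Tx) *\<^sub>v ones_vec j"
    unfolding AVy by (simp add: assoc_mult_mat_vec[of _ n n _ j])
  \<comment> \<open>In \<open>b - A *\<^sub>v x j\<close> the terms
    \<open>b - A *\<^sub>v x 0\<close> and \<open>VH *\<^sub>v y\<close> combine to
    \<open>r\<close>; the remaining three are the claimed gap, compared entry by entry.\<close>
  have "r_true = r - D *\<^sub>v y + (A * Tp) *\<^sub>v y - (A * Tx) *\<^sub>v ones_vec j"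
    unfolding r_true r r0 Ax VH_def[symmetric]
    using x0 by (intro eq_vecI) (auto simp del: index_mult_mat_vec simp: carrier_matD[OF A]
        carrier_matD[OF carr(5)] carrier_matD[OF carr(6)])
  then show ?thesis unfolding D_def Tp_def Tx_def .
qed

end
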